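(* Let $n\ge1$ and $0\le k\le n$. The transpose $M_{n,k}^{T}$ of the cyclic $(n,k)$-matrix is optimal.
   Context: Indices run from $0$ to $n-1$. The cyclic $(n,k)$-matrix $M_{n,k}=(m_{i,j})_{0\le i,j\le n-1}$ has $m_{i,j}=1$ iff $j\equiv ik+a\pmod n$ for some $0\le a\le k-1$, and $0$ otherwise; so the entry $(i,j)$ of $M_{n,k}^T$ is $1$ iff $i\equiv jk+a\pmod n$ for some $0\le a\le k-1$. Biker–hiker model: $n$ travellers $t_0,\dots,t_{n-1}$; posts $P_0,\dots,P_n$ at unit spacing; stage $s_j$ is the leg from $P_j$ to $P_{j+1}$. All start at $P_0$ at time $0$, walk at common speed $w$, cycle at common speed $v>w$, mode changes take no time. An $n\times n$ binary matrix $M$ prescribes that $t_i$ cycles $s_j$ iff $m_{i,j}=1$. $M$ is $k$-uniform if every row and every column has exactly $k$ ones. Bicycles start at $P_0$, move only when ridden by one rider, and a traveller due to cycle $s_j$ must take a bicycle present at $P_j$ when he arrives there. $M$ is optimal if it is $k$-uniform for some $k$ and, with $k$ bicycles, the scheme can be executed with no traveller ever having to wait for a bicycle. *)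

theory Defs
  imports Complex_Main "HOL-Number_Theory.Cong" "Jordan_Normal_Form.Matrix"
begin

definition cyclic_mat :: "nat \<Rightarrow> nat \<Rightarrow> nat mat" where
  "cyclic_mat n k = mat n n (\<lambda>(i, j). if \<exists>a<k. [j = i * k + a] (mod n) then 1 else 0)"

definition binary_mat :: "nat \<Rightarrow> nat mat \<Rightarrow> bool" where
  "binary_mat n M \<longleftrightarrow> M \<in> carrier_mat n n \<and> elements_mat M \<subseteq> {0, 1}"

definition uniform_mat :: "nat \<Rightarrow> nat \<Rightarrow> nat mat \<Rightarrow> bool" where
  "uniform_mat n k M \<longleftrightarrow> binary_mat n M \<and>
     (\<forall>i<n. card {j. j < n \<and> M $$ (i, j) = 1} = k) \<and>
     (\<forall>j<n. card {i. i < n \<and> M $$ (i, j) = 1} = k)"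

definition leg_speed :: "real \<Rightarrow> real \<Rightarrow> nat mat \<Rightarrow> nat \<Rightarrow> nat \<Rightarrow> real" where
  "leg_speed w v M i j = (if M $$ (i, j) = 1 then v else w)"

text \<open>The time at which traveller i reaches post j if he never waits; posts are at unit spacing.
  This is also the time at which he leaves post j, since mode changes take no time.\<close>

definition arrival :: "real \<Rightarrow> real \<Rightarrow> nat mat \<Rightarrow> nat \<Rightarrow> nat \<Rightarrow> real" where
  "arrival w v M i j = (\<Sum>l<j. 1 / leg_speed w v M i l)"

definition rides :: "nat \<Rightarrow> nat mat \<Rightarrow> (nat \<Rightarrow> nat \<Rightarrow> nat) \<Rightarrow> nat \<Rightarrow> (nat \<times> nat) set" where
  "rides n M bike b = {(i, j). i < n \<and> j < n \<and> M $$ (i, j) = 1 \<and> bike i j = b}"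

definition ride_time :: "real \<Rightarrow> real \<Rightarrow> nat mat \<Rightarrow> nat \<times> nat \<Rightarrow> real set" where
  "ride_time w v M = (\<lambda>(i, j). {arrival w v M i j <..< arrival w v M i (Suc j)})"

text \<open>An execution without waiting, using the bicycles \<open>0, \<dots>, k - 1\<close>: \<open>bike i j\<close> is the bicycle
  that traveller i rides on stage j (relevant only if he cycles that stage), and \<open>pos b t\<close> is the
  position of bicycle b at time t.
  The second conjunct says that a bicycle moves along with its rider; at the left end point of the
  time interval it says that the bicycle is present at post j when the rider arrives there.
  The fourth says that a bicycle moves only when ridden: it stays put during any period in which
  nobody rides it.
  Ride intervals of one bicycle may share an end point: a bicycle may be taken at the very moment
  at which it is left, and a rider may keep his bicycle for the next stage.\<close>

definition no_wait_execution ::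
  "real \<Rightarrow> real \<Rightarrow> nat \<Rightarrow> nat \<Rightarrow> nat mat \<Rightarrow> (nat \<Rightarrow> nat \<Rightarrow> nat) \<Rightarrow> (nat \<Rightarrow> real \<Rightarrow> real) \<Rightarrow> bool" where
  "no_wait_execution w v n k M bike pos \<longleftrightarrow>
     (\<forall>i<n. \<forall>j<n. M $$ (i, j) = 1 \<longrightarrow> bike i j < k) \<and>
     (\<forall>b<k. \<forall>(i, j) \<in> rides n M bike b.
        \<forall>t \<in> {arrival w v M i j .. arrival w v M i (Suc j)}.
          pos b t = real j + v * (t - arrival w v M i j)) \<and>
     (\<forall>b<k. pos b 0 = 0) \<and>
     (\<forall>b<k. \<forall>s t. 0 \<le> s \<and> s < t \<and>
        (\<forall>r \<in> rides n M bike b. {s<..<t} \<inter> ride_time w v M r = {}) \<longrightarrow> pos b s = pos b t) \<and>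
     (\<forall>b<k. \<forall>r \<in> rides n M bike b. \<forall>r' \<in> rides n M bike b.
        r \<noteq> r' \<longrightarrow> ride_time w v M r \<inter> ride_time w v M r' = {})"

definition optimal :: "real \<Rightarrow> real \<Rightarrow> nat \<Rightarrow> nat mat \<Rightarrow> bool" where
  "optimal w v n M \<longleftrightarrow>
     (\<exists>k. uniform_mat n k M \<and> (\<exists>bike pos. no_wait_execution w v n k M bike pos))"

end

theory Submission
  imports Defs
begin

text \<open>On stage \<open>j\<close> the cyclists are the \<open>k\<close> cyclically consecutive travellers starting with
  \<open>r = jk mod n\<close>. Hence at post \<open>j\<close> the travellers \<open>i < r\<close> have cycled exactly one stage more
  than the travellers \<open>i \<ge> r\<close>, so that arrival times are nondecreasing in \<open>i\<close> and take only
  two values. On every stage, let bicycle \<open>b\<close> be ridden by the cyclist with the \<open>b\<close>-th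
  smallest index. At each post at least as many cyclists of the previous stage arrive early as
  cyclists of the next stage do, so bicycle \<open>b\<close> is always there in time.\<close>

declare One_nat_def [simp del]

subsection \<open>Executions from an assignment of riders\<close>

lemma arrival_Suc: "arrival w v M i (Suc j) = arrival w v M i j + 1 / leg_speed w v M i j"
  by (simp add: arrival_def)

lemma arrival_nonneg:
  assumes "0 < w" "0 < v"
  shows "0 \<le> arrival w v M i j"
  using assms by (auto simp: arrival_def leg_speed_def intro!: sum_nonneg)

text \<open>Every cycled stage saves the same time \<open>1 / w - 1 / v\<close> over walking it, so
  the order in which stages are cycled does not matter.\<close>

lemma arrival_eq_card:
  assumes "0 < w" "0 < v"
  shows "arrival w v M i j = j / w - card {l. l < j \<and> M $$ (i, l) = 1} * (1 / w - 1 / v)"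
proof (induction j)
  case 0
  then show ?case by (simp add: arrival_def)
next
  case (Suc j)
  have "{l. l < Suc j \<and> M $$ (i, l) = 1} =
      (if M $$ (i, j) = 1 then insert j {l. l < j \<and> M $$ (i, l) = 1}
       else {l. l < j \<and> M $$ (i, l) = 1})"
    by (auto simp: less_Suc_eq)
  then show ?case
    by (simp add: arrival_Suc Suc leg_speed_def field_simps add_divide_distrib)
qed

text \<open>Clamping to the unit interval gives the contribution of a single ride to the position of
  a bicycle: 0 before the ride, linear during it, 1 afterwards.\<close>

definition ramp :: "real \<Rightarrow> real" where
  "ramp x = max 0 (min 1 x)"

lemma ramp_eq_0: "x \<le> 0 \<Longrightarrow> ramp x = 0"
  and ramp_eq_1: "1 \<le> x \<Longrightarrow> ramp x = 1"
  and ramp_eq_self: "0 \<le> x \<Longrightarrow> x \<le> 1 \<Longrightarrow> ramp x = x"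
  by (auto simp: ramp_def)

lemma ride_starts_mono:
  fixes S :: "nat \<Rightarrow> real"
  assumes "\<And>j. Suc j < n \<Longrightarrow> S j + d \<le> S (Suc j)" and "0 \<le> d" and "i < j" and "j < n"
  shows "S i + d \<le> S j"
  using \<open>i < j\<close> \<open>j < n\<close>
proof (induction j)
  case (Suc j)
  show ?case
  proof (cases "i = j")
    case False
    with Suc have "S i + d \<le> S j" by simp
    also have "\<dots> \<le> S (Suc j)" using assms(1)[of j] Suc.prems \<open>0 \<le> d\<close> by simp
    finally show ?thesis .
  qed (use assms(1) Suc.prems in auto)
qed simp

text \<open>Each bicycle is ridden exactly once on every stage, so it is enough to compare
  consecutive riders: the rider of stage \<open>j\<close> must bring it to the next post no later
  than its next rider arrives there.\<close>

lemma no_wait_execution_of_riders: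
  fixes \<sigma> :: "nat \<Rightarrow> nat \<Rightarrow> nat"
  assumes w: "0 < w" and v: "0 < v"
    and bij: "\<And>j. j < n \<Longrightarrow> bij_betw (\<sigma> j) {..<k} {i. i < n \<and> M $$ (i, j) = 1}"
    and handover: "\<And>j b. Suc j < n \<Longrightarrow> b < k \<Longrightarrow>
      arrival w v M (\<sigma> j b) (Suc j) \<le> arrival w v M (\<sigma> (Suc j) b) (Suc j)"
  shows "\<exists>bike pos. no_wait_execution w v n k M bike pos"
proof -
  define bike where "bike i j = the_inv_into {..<k} (\<sigma> j) i" for i j
  define S where "S b j = arrival w v M (\<sigma> j b) j" for b j
  \<comment> \<open>The rides of a bicycle follow each other in stage order, each adding one unit of
    distance.\<close>
  define pos where "pos b t = (\<Sum>j<n. ramp (v * (t - S b j)))" for b t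
  have rider: "\<sigma> j b < n" "M $$ (\<sigma> j b, j) = 1" if "j < n" "b < k" for j b
    using bij[OF that(1)] that(2) by (auto simp: bij_betw_def)
  have bike: "bike i j < k \<and> \<sigma> j (bike i j) = i" if "i < n" "j < n" "M $$ (i, j) = 1" for i j
  proof -
    have "inj_on (\<sigma> j) {..<k}" "i \<in> \<sigma> j ` {..<k}"
      using bij[OF that(2)] that by (auto simp: bij_betw_def)
    then show ?thesis
      unfolding bike_def by (metis f_the_inv_into_f lessThan_iff order_refl the_inv_into_into)
  qed
  have bike_rider: "bike (\<sigma> j b) j = b" if "j < n" "b < k" for j b
    using bij[OF that(1)] that(2) by (simp add: bike_def bij_betw_def the_inv_into_f_f)
  have rides: "rides n M bike b = (\<lambda>j. (\<sigma> j b, j)) ` {..<n}" if "b < k" for b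
  proof (intro equalityI subsetI)
    fix r assume "r \<in> rides n M bike b"
    then obtain i j where r: "r = (i, j)" "i < n" "j < n" "M $$ (i, j) = 1" "bike i j = b"
      by (auto simp: rides_def)
    then have "r = (\<sigma> j b, j)" using bike[of i j] by simp
    with \<open>j < n\<close> show "r \<in> (\<lambda>j. (\<sigma> j b, j)) ` {..<n}" by simp
  qed (use that rider bike_rider in \<open>auto simp: rides_def\<close>)
  have S_end: "arrival w v M (\<sigma> j b) (Suc j) = S b j + 1 / v" if "j < n" "b < k" for j b
    using rider(2)[OF that] by (simp add: arrival_Suc S_def leg_speed_def)
  have S_mono: "S b i + 1 / v \<le> S b j" if "b < k" "i < j" "j < n" for b i j
  proof (rule ride_starts_mono[of n])
    show "S b l + 1 / v \<le> S b (Suc l)" if "Suc l < n" for l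
      using handover[OF that \<open>b < k\<close>] S_end[of l b] that \<open>b < k\<close> by (simp add: S_def)
  qed (use that v in auto)
  have ramp_after: "ramp (v * (t - S b j)) = 1" if "S b j + 1 / v \<le> t" for b j t
    using that v by (intro ramp_eq_1) (simp add: field_simps)
  have ramp_before: "ramp (v * (t - S b j)) = 0" if "t \<le> S b j" for b j t
    using that v by (intro ramp_eq_0) (simp add: mult_le_0_iff)
  have riding: "pos b t = real j + v * (t - S b j)"
    if t: "b < k" "j < n" "S b j \<le> t" "t \<le> S b j + 1 / v" for b j t
  proof -
    \<comment> \<open>During the ride on stage \<open>j\<close>, all earlier rides are complete and
      no later one has progressed.\<close>
    have "ramp (v * (t - S b l)) = (if l < j then 1 else if l = j then v * (t - S b j) else 0)"
      if l: "l < n" for l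
    proof (cases l j rule: linorder_cases)
      case less
      with S_mono[of b l j] t have "S b l + 1 / v \<le> t" by simp
      with less show ?thesis by (simp add: ramp_after)
    next
      case equal
      with t v show ?thesis by (simp add: ramp_eq_self field_simps)
    next
      case greater
      with S_mono[of b j l] t l have "t \<le> S b l" by simp
      with greater show ?thesis by (simp add: ramp_before)
    qed
    then have "pos b t = (\<Sum>l<n. (if l < j then 1 else 0) + (if l = j then v * (t - S b j) else 0))"
      unfolding pos_def by (intro sum.cong) auto
    also have "\<dots> = (\<Sum>l<n. if l < j then 1 else 0) + v * (t - S b j)"
      using \<open>j < n\<close> by (simp add: sum.distrib)
    also have "(\<Sum>l<n. if l < j then 1 else 0) = (\<Sum>l<j. 1 :: real)"
      using \<open>j < n\<close> by (intro sum.mono_neutral_cong_right) auto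
    finally show ?thesis by simp
  qed
  have start: "pos b 0 = 0" for b
    unfolding pos_def
    by (intro sum.neutral ballI ramp_before) (simp add: S_def arrival_nonneg[OF w v])
  have resting: "pos b s = pos b t"
    if "s < t" and idle: "\<And>j. j < n \<Longrightarrow> {s<..<t} \<inter> {S b j<..<S b j + 1 / v} = {}" for b s t
    unfolding pos_def
  proof (rule sum.cong[OF refl])
    fix j assume "j \<in> {..<n}"
    \<comment> \<open>Two nonempty open intervals are disjoint only if one ends before the other
      begins; hence each ramp is constant between \<open>s\<close> and \<open>t\<close>.\<close>
    then have "t \<le> S b j \<or> S b j + 1 / v \<le> s"
      using idle[of j] \<open>s < t\<close> v by (auto simp: min_def max_def split: if_splits)
    then show "ramp (v * (s - S b j)) = ramp (v * (t - S b j))"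
      using \<open>s < t\<close> ramp_before[of _ b j] ramp_after[of b j] by auto
  qed
  have "no_wait_execution w v n k M bike pos"
    unfolding no_wait_execution_def
  proof (intro conjI)
    show "\<forall>i<n. \<forall>j<n. M $$ (i, j) = 1 \<longrightarrow> bike i j < k"
      using bike by blast
    show "\<forall>b<k. \<forall>(i, j) \<in> rides n M bike b.
        \<forall>t \<in> {arrival w v M i j .. arrival w v M i (Suc j)}.
          pos b t = real j + v * (t - arrival w v M i j)"
      using riding by (auto simp: rides S_end simp flip: S_def)
    show "\<forall>b<k. pos b 0 = 0"
      using start by simp
    show "\<forall>b<k. \<forall>s t. 0 \<le> s \<and> s < t \<and>
        (\<forall>r \<in> rides n M bike b. {s<..<t} \<inter> ride_time w v M r = {}) \<longrightarrow> pos b s = pos b t"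
      using resting by (simp add: rides ride_time_def S_end flip: S_def)
    have "{S b i<..<S b i + 1 / v} \<inter> {S b j<..<S b j + 1 / v} = {}"
      if "b < k" "i < n" "j < n" "i \<noteq> j" for b i j
      using S_mono[of b i j] S_mono[of b j i] that by (cases i j rule: linorder_cases) auto
    then show "\<forall>b<k. \<forall>r \<in> rides n M bike b. \<forall>r' \<in> rides n M bike b.
        r \<noteq> r' \<longrightarrow> ride_time w v M r \<inter> ride_time w v M r' = {}"
      by (auto simp: rides ride_time_def S_end simp flip: S_def)
  qed
  then show ?thesis by blast
qed

subsection \<open>The transposed cyclic matrix\<close>

text \<open>As \<open>k \<le> n\<close>, adding \<open>k\<close> to a residue passes
  \<open>n\<close> at most once.\<close>

lemma mod_add_less:
  fixes x k n :: nat
  assumes "k \<le> n" "0 < n"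
  shows "(x + k) mod n = (if x mod n + k < n then x mod n + k else x mod n + k - n)"
    and "(x + k) div n = (if x mod n + k < n then x div n else Suc (x div n))"
proof -
  have r: "x mod n < n" using assms by simp
  have "x + k = n * (x div n) + (x mod n + k)" by simp
  then have "(x + k) mod n = (x mod n + k) mod n" "(x + k) div n = x div n + (x mod n + k) div n"
    using assms by (metis mod_mult_self4, metis div_mult_self4 add.commute not_gr_zero)
  moreover have "(x mod n + k) mod n = x mod n + k - n" "(x mod n + k) div n = 1"
    if "n \<le> x mod n + k"
  proof -
    have "x mod n + k - n < n" using r \<open>k \<le> n\<close> by linarith
    then show "(x mod n + k) mod n = x mod n + k - n" "(x mod n + k) div n = 1"
      using that assms le_mod_geq[OF that] le_div_geq[OF \<open>0 < n\<close> that]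
      by (simp_all only: mod_less div_less One_nat_def)
  qed
  ultimately show "(x + k) mod n = (if x mod n + k < n then x mod n + k else x mod n + k - n)"
    and "(x + k) div n = (if x mod n + k < n then x div n else Suc (x div n))"
    by (simp_all add: not_less)
qed

text \<open>The ones of a column form a cyclic interval of length \<open>k\<close>; the last
  disjunct is the part that has wrapped around to the top rows.\<close>

lemma transpose_cyclic_mat_eq_1_iff:
  assumes "k \<le> n" "i < n" "j < n"
  shows "transpose_mat (cyclic_mat n k) $$ (i, j) = 1 \<longleftrightarrow>
    (j * k mod n \<le> i \<and> i < j * k mod n + k) \<or> i + n < j * k mod n + k"
proof -
  define r where "r = j * k mod n"
  have r: "r < n" using assms by (simp add: r_def)
  have "[i = j * k + a] (mod n) \<longleftrightarrow> i = r + a \<or> i + n = r + a" if "a < k" for a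
    using mod_add_less(1)[of a n "j * k"] that assms r by (auto simp: cong_def r_def)
  then have "transpose_mat (cyclic_mat n k) $$ (i, j) = 1 \<longleftrightarrow>
      (\<exists>a<k. i = r + a \<or> i + n = r + a)"
    using assms by (auto simp: cyclic_mat_def)
  also have "\<dots> \<longleftrightarrow> (r \<le> i \<and> i < r + k) \<or> i + n < r + k"
  proof
    assume "(r \<le> i \<and> i < r + k) \<or> i + n < r + k"
    then show "\<exists>a<k. i = r + a \<or> i + n = r + a"
    proof
      assume "r \<le> i \<and> i < r + k"
      then show ?thesis by (intro exI[of _ "i - r"]) auto
    next
      assume "i + n < r + k"
      then show ?thesis using r by (intro exI[of _ "i + n - r"]) auto
    qed
  qed auto
  finally show ?thesis by (simp add: r_def)
qed

text \<open>The cyclic interval of each stage begins where the previous one ends. The first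
  \<open>j\<close> of them thus wind around the residues modulo \<open>n\<close> in
  \<open>j * k\<close> consecutive steps from 0: \<open>j * k div n\<close> full turns, then once
  more over the residues below \<open>j * k mod n\<close>.\<close>

lemma card_cycled_stages:
  assumes "k \<le> n" "i < n" "j \<le> n"
  shows "card {l. l < j \<and> transpose_mat (cyclic_mat n k) $$ (i, l) = 1} =
    j * k div n + (if i < j * k mod n then 1 else 0)"
  using \<open>j \<le> n\<close>
proof (induction j)
  case (Suc j)
  let ?M = "transpose_mat (cyclic_mat n k)"
  define q r where "q = j * k div n" and "r = j * k mod n"
  have split: "{l. l < Suc j \<and> ?M $$ (i, l) = 1} =
      (if ?M $$ (i, j) = 1 then insert j {l. l < j \<and> ?M $$ (i, l) = 1}
       else {l. l < j \<and> ?M $$ (i, l) = 1})"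
    by (auto simp: less_Suc_eq)
  have next_post: "Suc j * k div n = (if r + k < n then q else Suc q)"
    "Suc j * k mod n = (if r + k < n then r + k else r + k - n)"
    using mod_add_less[of k n "j * k"] assms unfolding q_def r_def
    by (simp_all only: mult_Suc add.commute[of k])
  have cycled: "?M $$ (i, j) = 1 \<longleftrightarrow> (r \<le> i \<and> i < r + k) \<or> i + n < r + k"
    unfolding r_def using transpose_cyclic_mat_eq_1_iff[of k n i j] assms Suc.prems by simp
  have IH: "card {l. l < j \<and> ?M $$ (i, l) = 1} = q + (if i < r then 1 else 0)"
    using Suc by (simp add: q_def r_def)
  have "r < n" using assms by (simp add: r_def)
  then show ?case
    unfolding split next_post cycled using assms IH by (auto split: if_splits)
qed simp

text \<open>Those with index below \<open>j * k mod n\<close> have cycled one stage more and, since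
  \<open>w < v\<close>, form the early group.\<close>

lemma arrival_le_arrival_iff:
  assumes "k \<le> n" "i < n" "i' < n" "j \<le> n" "0 < w" "w < v"
  shows "arrival w v (transpose_mat (cyclic_mat n k)) i j
      \<le> arrival w v (transpose_mat (cyclic_mat n k)) i' j \<longleftrightarrow>
    (i' < j * k mod n \<longrightarrow> i < j * k mod n)"
proof -
  have "0 < 1 / w - 1 / v" using assms by (simp add: field_simps)
  then show ?thesis
    using assms by (simp add: arrival_eq_card card_cycled_stages mult_le_cancel_right_pos)
qed

text \<open>If the interval wraps, the cyclists are the indices below \<open>r + k - n\<close> and
  those from \<open>r\<close> to \<open>n - 1\<close>; the shift \<open>n - k\<close> sends
  \<open>b = r + k - n\<close> to \<open>r\<close>.\<close>

definition nth_cyclist :: "nat \<Rightarrow> nat \<Rightarrow> nat \<Rightarrow> nat \<Rightarrow> nat" where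
  "nth_cyclist n k j b = (let r = j * k mod n in
     if r + k \<le> n then r + b else if b + n < r + k then b else b + (n - k))"

lemma bij_betw_nth_cyclist:
  assumes "k \<le> n" "j < n"
  shows "bij_betw (nth_cyclist n k j) {..<k}
    {i. i < n \<and> transpose_mat (cyclic_mat n k) $$ (i, j) = 1}"
proof -
  define r where "r = j * k mod n"
  have r: "r < n" using assms by (simp add: r_def)
  have C: "{i. i < n \<and> transpose_mat (cyclic_mat n k) $$ (i, j) = 1} =
      {i. i < n \<and> ((r \<le> i \<and> i < r + k) \<or> i + n < r + k)}"
    using assms by (auto simp: transpose_cyclic_mat_eq_1_iff r_def)
  show ?thesis
    unfolding C
    by (rule bij_betwI[where g = "\<lambda>i. if r + k \<le> n then i - r
          else if i + n < r + k then i else i - (n - k)"])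
      (use r \<open>k \<le> n\<close> in \<open>auto simp: nth_cyclist_def Let_def simp flip: r_def\<close>)
qed

text \<open>Let \<open>r'\<close> be \<open>Suc j * k mod n\<close>. If stage \<open>j\<close> does
  not wrap, then either all its cyclists lie below \<open>r'\<close> or \<open>r' = 0\<close>. If it
  wraps, its cyclists below \<open>r'\<close> are those with \<open>b < r'\<close>, while on the
  next stage only \<open>b < r' + k - n \<le> r'\<close> can give an index below
  \<open>r'\<close>.\<close>

lemma nth_cyclist_handover:
  assumes "k \<le> n" "0 < n" "b < k"
    and "nth_cyclist n k (Suc j) b < Suc j * k mod n"
  shows "nth_cyclist n k j b < Suc j * k mod n"
proof -
  have "Suc j * k = j * k + k" by simp
  moreover have "j * k mod n < n" using assms by simp
  ultimately show ?thesis
    using assms mod_add_less(1)[of k n "j * k"]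
    by (auto simp: nth_cyclist_def Let_def simp del: mult_Suc split: if_splits)
qed

lemma uniform_transpose_cyclic_mat:
  assumes "k \<le> n"
  shows "uniform_mat n k (transpose_mat (cyclic_mat n k))"
  unfolding uniform_mat_def binary_mat_def
proof (intro conjI allI impI)
  show "transpose_mat (cyclic_mat n k) \<in> carrier_mat n n"
    by (simp add: cyclic_mat_def)
  show "elements_mat (transpose_mat (cyclic_mat n k)) \<subseteq> {0, 1}"
    by (auto simp: elements_mat_def cyclic_mat_def)
  \<comment> \<open>After all \<open>n\<close> stages the winding consists of exactly
    \<open>k\<close> full turns.\<close>
  show "card {j. j < n \<and> transpose_mat (cyclic_mat n k) $$ (i, j) = 1} = k" if "i < n" for i
    using card_cycled_stages[of k n i n] that assms by simp
  show "card {i. i < n \<and> transpose_mat (cyclic_mat n k) $$ (i, j) = 1} = k" if "j < n" for j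
    using bij_betw_same_card[OF bij_betw_nth_cyclist[OF assms that]] by simp
qed

theorem theorem5p1:
  fixes n k :: nat and w v :: real
  assumes "n \<ge> 1" and "k \<le> n" and "0 < w" and "w < v"
  shows "optimal w v n (transpose_mat (cyclic_mat n k))"
proof -
  let ?M = "transpose_mat (cyclic_mat n k)"
  have cyclist_less: "nth_cyclist n k j b < n" if "j < n" "b < k" for j b
    using bij_betw_nth_cyclist[OF \<open>k \<le> n\<close> that(1)] that(2) by (auto simp: bij_betw_def)
  have "\<exists>bike pos. no_wait_execution w v n k ?M bike pos"
  proof (rule no_wait_execution_of_riders[where \<sigma> = "nth_cyclist n k"])
    \<comment> \<open>With only two arrival times at a post, this says that if the next rider is in
      the early group, so is the previous one.\<close>
    show "arrival w v ?M (nth_cyclist n k j b) (Suc j)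
        \<le> arrival w v ?M (nth_cyclist n k (Suc j) b) (Suc j)" if "Suc j < n" "b < k" for j b
      using that assms cyclist_less nth_cyclist_handover[of k n b j]
      by (subst arrival_le_arrival_iff) auto
  qed (use assms bij_betw_nth_cyclist in auto)
  then show ?thesis
    using uniform_transpose_cyclic_mat[OF \<open>k \<le> n\<close>] unfolding optimal_def by blast
qed

end
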